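(* Let $m\ge 2$ and let $X_1,\dots,X_m$ be independent real random variables with probability densities $f_{X_1},\dots,f_{X_m}$; write $f_X=f_{X_1}$. Let $g_m$ be the density and $G_m$ the cumulative distribution function of $\prod_{j=1}^m X_j$, and let $g_{m-1}$ be the density of $\prod_{j=2}^m X_j$. Suppose that $f_X$ is bounded. For $1\le k\le n$ let $f_{\tilde X}$ (which depends on $n$ and $k$) be the density of the first factor $\tilde X$ of the $k$-th order statistic of a length-$n$ sample of the product $\prod_{i=1}^m X_i$. Then, as $n\to\infty$ with $k=k(n)$ such that $k/n\to\eta$, where $0<\eta<1$, $$\lim_{n\to\infty,\;k/n\to\eta} f_{\tilde X}(x)=\frac{g_{m-1}(\beta/x)}{g_m(\beta)\,|x|}\,f_X(x),\qquad \beta=G_m^{-1}(\eta).$$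
   Context: A length-$n$ sample of the product is built as follows: let $(X_{j,1},\dots,X_{j,m})$, $j=1,\dots,n$, be $n$ independent copies of $(X_1,\dots,X_m)$, and put $U_j=\prod_{i=1}^m X_{j,i}$. The $k$-th order statistic is the $k$-th smallest of $U_1,\dots,U_n$ (almost surely there are no ties). Let $J$ be the almost surely unique index such that $U_J$ is the $k$-th smallest product; the first factor of the $k$-th order statistic is $\tilde X:=X_{J,1}$. $G_m^{-1}$ denotes the inverse function of $G_m$. As usual, identities between densities are understood for almost every $x$.
   Formalization: Added assumptions: g_m is continuous at β with g_m(β)>0, and g_{m-1} is continuous at β/x for almost every x; without them g_m(β) is undefined or the limit can fail (e.g. X_1 uniform on [1,2], f_{X_2} built from a fat Cantor set). *)

theory Defs
  imports "HOL-Probability.Probability"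
begin

definition has_density :: "'a measure \<Rightarrow> ('a \<Rightarrow> real) \<Rightarrow> (real \<Rightarrow> real) \<Rightarrow> bool" where
  "has_density M X f \<longleftrightarrow> (\<forall>x. 0 \<le> f x) \<and> distributed M lborel X (\<lambda>x. ennreal (f x))"

text \<open>\<open>Z j i\<close> is the \<open>i\<close>-th coordinate of the \<open>j\<close>-th copy. Independence is required
  between the random vectors \<open>(Z j 1, \<dots>, Z j m)\<close>, and each of them has the joint
  law of \<open>(X 1, \<dots>, X m)\<close>.\<close>

definition indep_copies ::
  "'a measure \<Rightarrow> nat \<Rightarrow> (nat \<Rightarrow> 'a \<Rightarrow> real) \<Rightarrow> nat \<Rightarrow> 'b measure \<Rightarrow> (nat \<Rightarrow> nat \<Rightarrow> 'b \<Rightarrow> real) \<Rightarrow> bool"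
where
  "indep_copies M m X n N Z \<longleftrightarrow>
     prob_space N \<and>
     prob_space.indep_vars N (\<lambda>_. Pi\<^sub>M {1..m} (\<lambda>_. borel)) (\<lambda>j \<omega>. \<lambda>i\<in>{1..m}. Z j i \<omega>) {1..n} \<and>
     (\<forall>j\<in>{1..n}.
        distr N (Pi\<^sub>M {1..m} (\<lambda>_. borel)) (\<lambda>\<omega>. \<lambda>i\<in>{1..m}. Z j i \<omega>) =
        distr M (Pi\<^sub>M {1..m} (\<lambda>_. borel)) (\<lambda>\<omega>. \<lambda>i\<in>{1..m}. X i \<omega>))"

text \<open>The \<open>k\<close>-th smallest of \<open>u 1, \<dots>, u n\<close>, for \<open>1 \<le> k \<le> n\<close>.\<close>

definition order_stat :: "nat \<Rightarrow> nat \<Rightarrow> (nat \<Rightarrow> real) \<Rightarrow> real" where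
  "order_stat n k u = sort (map u [1..<Suc n]) ! (k - 1)"

text \<open>The index attaining the order statistic is almost surely unique; \<open>LEAST\<close> only breaks
  ties on a null set, keeping the index in \<open>{1..n}\<close> and the factor measurable there.\<close>

definition order_stat_index :: "nat \<Rightarrow> nat \<Rightarrow> (nat \<Rightarrow> real) \<Rightarrow> nat" where
  "order_stat_index n k u = (LEAST j. j \<in> {1..n} \<and> u j = order_stat n k u)"

definition first_factor ::
  "nat \<Rightarrow> nat \<Rightarrow> nat \<Rightarrow> (nat \<Rightarrow> nat \<Rightarrow> 'b \<Rightarrow> real) \<Rightarrow> 'b \<Rightarrow> real"
where
  "first_factor m n k Z \<omega> = Z (order_stat_index n k (\<lambda>j. \<Prod>i=1..m. Z j i \<omega>)) 1 \<omega>"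

end

theory Submission
  imports Defs "HOL-Real_Asymp.Real_Asymp"
begin

text \<open>
  Conditioning on which copy \<open>j\<close> attains the \<open>k\<close>-th smallest product and on which \<open>k - 1\<close> copies
  lie below it shows that \<open>\<P>(first factor \<in> A) = \<E>(1\<^sub>A(X 1) * h(U))\<close>, where \<open>U\<close> is the product,
  \<open>h u = b(G u)\<close> and \<open>b\<close> is the density of the \<open>k\<close>-th order statistic of \<open>n\<close> uniform variables.
  Hence the first factor has density
  \<open>fX x * (\<integral>t. g_tail t * h (x * t)) = fX x * (\<integral>u. h u * q u)\<close> with \<open>q u = g_tail (u / x) / \<bar>x\<bar>\<close>,
  and taking \<open>A = UNIV\<close> gives \<open>(\<integral>u. h u * g_m u) = 1\<close>. By Hoeffding's inequality \<open>h\<close> tends to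
  \<open>0\<close> uniformly away from \<open>\<beta>\<close>, so \<open>h * g_m\<close> concentrates at \<open>\<beta>\<close> and
  \<open>(\<integral>u. h u * q u)\<close> tends to \<open>q \<beta> / g_m \<beta>\<close>.
\<close>

subsection \<open>Rank of the order statistic\<close>

text \<open>Distinct values sort into a strictly increasing list, so the entry at position
  \<open>a\<close>, counted from 0, has exactly \<open>a\<close> values below it; rank
  \<open>k\<close> thus means \<open>k - 1\<close> smaller values. A count of comparisons with
  \<open>u j\<close> can later be integrated by independence, which the \<open>LEAST\<close> index
  cannot.\<close>

lemma order_stat_index_eq_iff:
  assumes inj: "inj_on u {1..n}" and k: "1 \<le> k" "k \<le> n" and j: "j \<in> {1..n}"
  shows "order_stat_index n k u = j \<longleftrightarrow> card {i\<in>{1..n} - {j}. u i < u j} = k - 1"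
proof -
  define xs where "xs = sort (map u [1..<Suc n])"
  have set_xs: "set xs = u ` {1..n}" and len: "length xs = n"
    by (auto simp: xs_def atLeastLessThanSuc_atLeastAtMost simp del: upt_Suc)
  have dist: "distinct xs"
    using inj by (simp add: xs_def distinct_map atLeastLessThanSuc_atLeastAtMost del: upt_Suc)
  have less_iff: "xs ! a < xs ! b \<longleftrightarrow> a < b" if "a < n" "b < n" for a b
  proof -
    have "sorted_wrt (<) xs"
      using dist by (simp add: strict_sorted_iff xs_def)
    then show ?thesis
      using that len sorted_wrt_nth_less[of "(<)" xs] by (metis linorder_neqE_nat order_less_asym)
  qed
  \<comment> \<open>Injectivity moves the count from indices to values; strictness identifies the
    values below \<open>xs ! a\<close> with the first \<open>a\<close> entries.\<close>
  have card_less: "card {i\<in>{1..n}. u i < xs ! a} = a" if a: "a < n" for a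
  proof -
    have "card {i\<in>{1..n}. u i < xs ! a} = card (u ` {i\<in>{1..n}. u i < xs ! a})"
      by (rule card_image[symmetric]) (rule inj_on_subset[OF inj], auto)
    also have "u ` {i\<in>{1..n}. u i < xs ! a} = {y\<in>set xs. y < xs ! a}"
      by (auto simp: set_xs)
    also have "\<dots> = (!) xs ` {..<a}"
    proof (intro equalityI subsetI)
      fix y assume "y \<in> {y\<in>set xs. y < xs ! a}"
      then obtain b where "b < n" "y = xs ! b" "xs ! b < xs ! a"
        using len by (auto simp: in_set_conv_nth)
      then show "y \<in> (!) xs ` {..<a}"
        using less_iff a by auto
    next
      fix y assume "y \<in> (!) xs ` {..<a}"
      then show "y \<in> {y\<in>set xs. y < xs ! a}"
        using less_iff a len by auto
    qed
    also have "card \<dots> = a"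
      using a len dist by (subst card_image) (auto intro!: inj_onI simp: nth_eq_iff_index_eq)
    finally show ?thesis .
  qed
  obtain a where a: "a < n" "xs ! a = u j"
    using j set_xs len by (metis imageI in_set_conv_nth)
  have "{i\<in>{1..n} - {j}. u i < u j} = {i\<in>{1..n}. u i < xs ! a}"
    using a by auto
  then have card_j: "card {i\<in>{1..n} - {j}. u i < u j} = a"
    using card_less[OF a(1)] by simp
  have os: "order_stat n k u = xs ! (k - 1)"
    by (simp add: order_stat_def xs_def)
  obtain j' where j': "j' \<in> {1..n}" "u j' = order_stat n k u"
    using set_xs len k os by (metis (no_types, lifting) One_nat_def Suc_le_eq Suc_pred imageE nth_mem le_trans)
  have "order_stat_index n k u \<in> {1..n} \<and> u (order_stat_index n k u) = order_stat n k u"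
    unfolding order_stat_index_def by (rule LeastI[of _ j']) (use j' in auto)
  \<comment> \<open>By injectivity only one index carries this value, so the choice made by
    \<open>LEAST\<close> is forced.\<close>
  then have "order_stat_index n k u = j \<longleftrightarrow> u j = xs ! (k - 1)"
    using inj j os by (metis inj_on_contraD)
  also have "\<dots> \<longleftrightarrow> a = k - 1"
    using a k dist len by (simp add: nth_eq_iff_index_eq flip: a(2))
  finally show ?thesis
    using card_j by simp
qed

lemma order_stat_index_in:
  assumes "1 \<le> k" "k \<le> n"
  shows "order_stat_index n k u \<in> {1..n}"
proof -
  have "order_stat n k u \<in> set (sort (map u [1..<Suc n]))"
    unfolding order_stat_def using assms by (intro nth_mem) auto
  then obtain j where "j \<in> {1..n} \<and> u j = order_stat n k u"
    by (auto simp: atLeastLessThanSuc_atLeastAtMost simp del: upt_Suc)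
  then show ?thesis
    unfolding order_stat_index_def by (rule LeastI2) auto
qed

subsection \<open>The uniform order statistic density\<close>

text \<open>The left side is the mass of the point \<open>a\<close> under the binomial law. This
  point lies in the two-sided deviation event, whose probability Hoeffding's inequality
  bounds.\<close>

lemma binomial_prob_le_exp:
  fixes p \<epsilon> :: real
  assumes "0 \<le> p" "p \<le> 1" "0 \<le> \<epsilon>" "a \<le> N" "0 < N" "\<epsilon> \<le> \<bar>real a / real N - p\<bar>"
  shows "real (N choose a) * p ^ a * (1 - p) ^ (N - a) \<le> 2 * exp (- 2 * real N * \<epsilon>\<^sup>2)"
proof -
  interpret binomial_distribution N p
    by standard (use assms in auto)
  have "real (N choose a) * p ^ a * (1 - p) ^ (N - a) = measure_pmf.prob (binomial_pmf N p) {a}"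
    using assms by (simp add: measure_pmf_single)
  also have "\<dots> \<le> measure_pmf.prob (binomial_pmf N p) {x. \<bar>x / N - p\<bar> \<ge> \<epsilon>}"
    by (rule measure_pmf.finite_measure_mono) (use assms in auto)
  also have "\<dots> \<le> 2 * exp (- 2 * real N * \<epsilon>\<^sup>2)"
    using prob_abs_ge'[of \<epsilon>] assms by simp
  finally show ?thesis .
qed

text \<open>The density at \<open>p\<close> of the \<open>k\<close>-th order statistic of \<open>n\<close> uniform variables on \<open>[0, 1]\<close>.\<close>

definition order_stat_kernel :: "nat \<Rightarrow> nat \<Rightarrow> real \<Rightarrow> real" where
  "order_stat_kernel n k p = real n * (real (n - 1 choose (k - 1)) * p ^ (k - 1) * (1 - p) ^ (n - k))"

lemma order_stat_kernel_nonneg: "0 \<le> p \<Longrightarrow> p \<le> 1 \<Longrightarrow> 0 \<le> order_stat_kernel n k p"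
  by (simp add: order_stat_kernel_def)

text \<open>A crude bound that grows with \<open>n\<close>; it serves for integrability at a fixed
  \<open>n\<close>.\<close>

lemma order_stat_kernel_le:
  assumes "0 \<le> p" "p \<le> 1"
  shows "order_stat_kernel n k p \<le> real n * real (n - 1 choose (k - 1))"
proof -
  have "p ^ (k - 1) * (1 - p) ^ (n - k) \<le> 1"
    using assms by (intro mult_le_one power_le_one) auto
  then have "real (n - 1 choose (k - 1)) * (p ^ (k - 1) * (1 - p) ^ (n - k)) \<le> real (n - 1 choose (k - 1)) * 1"
    by (intro mult_left_mono) auto
  then show ?thesis
    unfolding order_stat_kernel_def mult.assoc by (intro mult_left_mono) auto
qed

text \<open>The kernel is \<open>n\<close> times the probability of \<open>k - 1\<close> successes
  in \<open>n - 1\<close> trials, so Hoeffding's inequality calls for the limit of the shifted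
  ratio.\<close>

lemma order_stat_rank_limit:
  fixes k :: "nat \<Rightarrow> nat"
  assumes lim: "(\<lambda>n. real (k n) / real n) \<longlonglongrightarrow> \<eta>" and "0 < \<eta>" "\<eta> < 1"
  shows "eventually (\<lambda>n. 1 \<le> k n \<and> k n \<le> n) sequentially"
    and "(\<lambda>n. real (k n - 1) / real (n - 1)) \<longlonglongrightarrow> \<eta>"
proof -
  have pos: "eventually (\<lambda>n. 0 < real (k n) / real n) sequentially"
    and less: "eventually (\<lambda>n. real (k n) / real n < 1) sequentially"
    using order_tendstoD[OF lim] assms by auto
  show rank: "eventually (\<lambda>n. 1 \<le> k n \<and> k n \<le> n) sequentially"
    using pos less eventually_gt_at_top[of 0]
    by eventually_elim (auto simp: field_simps Suc_le_eq intro: ccontr)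
  \<comment> \<open>Factor \<open>(k - 1) / (n - 1)\<close> as
    \<open>(k / n - 1 / n) * (n / (n - 1))\<close>. This is valid once \<open>n > 1\<close> and
    \<open>1 \<le> k n\<close>, when the subtractions on naturals are genuine.\<close>
  have "(\<lambda>n. (real (k n) / real n - 1 / real n) * (real n / (real n - 1))) \<longlonglongrightarrow> (\<eta> - 0) * 1"
    by (intro tendsto_mult tendsto_diff lim) real_asymp+
  moreover have "eventually (\<lambda>n. (real (k n) / real n - 1 / real n) * (real n / (real n - 1))
      = real (k n - 1) / real (n - 1)) sequentially"
    using rank eventually_gt_at_top[of 1]
    by eventually_elim (auto simp: field_simps of_nat_diff)
  ultimately show "(\<lambda>n. real (k n - 1) / real (n - 1)) \<longlonglongrightarrow> \<eta>"
    by (simp add: tendsto_cong)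
qed

text \<open>Hoeffding's bound decays exponentially in \<open>n\<close> and does not depend on
  \<open>p\<close>, so it beats the prefactor \<open>n\<close> uniformly.\<close>

lemma order_stat_kernel_uniform_limit:
  fixes k :: "nat \<Rightarrow> nat"
  assumes lim: "(\<lambda>n. real (k n) / real n) \<longlonglongrightarrow> \<eta>" and \<eta>: "0 < \<eta>" "\<eta> < 1" and \<epsilon>: "0 < \<epsilon>"
  shows "uniform_limit {p. 0 \<le> p \<and> p \<le> 1 \<and> \<epsilon> \<le> \<bar>p - \<eta>\<bar>} (\<lambda>n. order_stat_kernel n (k n)) (\<lambda>_. 0) sequentially"
proof (rule uniform_limitI)
  fix e :: real assume e: "0 < e"
  have "(\<lambda>n. real n * (2 * exp (- 2 * real (n - 1) * (\<epsilon> / 2)\<^sup>2))) \<longlonglongrightarrow> 0"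
    using \<epsilon> by real_asymp
  then have small: "eventually (\<lambda>n. real n * (2 * exp (- 2 * real (n - 1) * (\<epsilon> / 2)\<^sup>2)) < e) sequentially"
    using e by (rule order_tendstoD)
  have near: "eventually (\<lambda>n. \<bar>real (k n - 1) / real (n - 1) - \<eta>\<bar> < \<epsilon> / 2) sequentially"
    using tendstoD[OF order_stat_rank_limit(2)[OF lim \<eta>], of "\<epsilon> / 2"] \<epsilon> by (simp add: dist_real_def)
  show "eventually (\<lambda>n. \<forall>p\<in>{p. 0 \<le> p \<and> p \<le> 1 \<and> \<epsilon> \<le> \<bar>p - \<eta>\<bar>}. dist (order_stat_kernel n (k n) p) 0 < e) sequentially"
    using small near order_stat_rank_limit(1)[OF lim \<eta>] eventually_gt_at_top[of 1]
  proof eventually_elim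
    case (elim n)
    show ?case
    proof
      fix p assume p: "p \<in> {p. 0 \<le> p \<and> p \<le> 1 \<and> \<epsilon> \<le> \<bar>p - \<eta>\<bar>}"
      \<comment> \<open>The ratio is within \<open>\<epsilon> / 2\<close> of \<open>\<eta>\<close>
        and \<open>p\<close> is at least \<open>\<epsilon>\<close> away from \<open>\<eta>\<close>,
        so half of \<open>\<epsilon>\<close> remains.\<close>
      have far: "\<epsilon> / 2 \<le> \<bar>real (k n - 1) / real (n - 1) - p\<bar>"
        using elim(2) p unfolding mem_Collect_eq by argo
      \<comment> \<open>Writing \<open>n - k n\<close> as \<open>(n - 1) - (k n - 1)\<close> exposes
        a binomial point probability with \<open>n - 1\<close> trials.\<close>
      have "order_stat_kernel n (k n) p
          = real n * (real (n - 1 choose (k n - 1)) * p ^ (k n - 1) * (1 - p) ^ (n - 1 - (k n - 1)))"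
        using elim by (simp add: order_stat_kernel_def)
      also have "\<dots> \<le> real n * (2 * exp (- 2 * real (n - 1) * (\<epsilon> / 2)\<^sup>2))"
        using elim(3,4) p \<epsilon> far by (intro mult_left_mono binomial_prob_le_exp) auto
      also note \<open>\<dots> < e\<close>
      finally show "dist (order_stat_kernel n (k n) p) 0 < e"
        using order_stat_kernel_nonneg[of p n "k n"] p by (simp add: dist_real_def)
    qed
  qed
qed

section \<open>Concentration of kernels at a point\<close>

text \<open>The functions \<open>h n * g\<close> form an approximate identity at \<beta>. The unit
  mass is taken with respect to the density \<open>g\<close>, not Lebesgue measure, so what is
  evaluated at \<beta> is the quotient of \<open>q\<close> by \<open>g\<close>.\<close>

lemma concentrating_kernel_limit:
  fixes h :: "nat \<Rightarrow> real \<Rightarrow> real" and g q :: "real \<Rightarrow> real"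
  assumes h [measurable]: "\<And>n. h n \<in> borel_measurable borel" and h_nonneg: "\<And>n u. 0 \<le> h n u"
    and h_bound: "\<And>n u. h n u \<le> B n"
    and g: "integrable lborel g" "\<And>u. 0 \<le> g u" "isCont g \<beta>" "0 < g \<beta>"
    and q: "integrable lborel q" "isCont q \<beta>"
    and mass: "eventually (\<lambda>n. (\<integral>u. h n u * g u \<partial>lborel) = 1) sequentially"
    and away: "\<And>\<delta>. 0 < \<delta> \<Longrightarrow> uniform_limit {u. \<delta> \<le> \<bar>u - \<beta>\<bar>} h (\<lambda>_. 0) sequentially"
  shows "(\<lambda>n. \<integral>u. h n u * q u \<partial>lborel) \<longlonglongrightarrow> q \<beta> / g \<beta>"
proof -
  \<comment> \<open>Subtracting the multiple of \<open>g\<close> that agrees with \<open>q\<close> at \<open>\<beta>\<close> reduces to a limit \<open>0\<close>.\<close>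
  define r where "r = q \<beta> / g \<beta>"
  define w where "w = (\<lambda>u. q u - r * g u)"
  have w_int: "integrable lborel w"
    unfolding w_def using g q by auto
  have w_cont: "isCont w \<beta>"
    unfolding w_def using g q by (intro continuous_intros)
  have w_\<beta>: "w \<beta> = 0"
    using g by (simp add: w_def r_def)
  have h_int: "integrable lborel (\<lambda>u. h n u * p u)" if "integrable lborel p" for n and p :: "real \<Rightarrow> real"
  proof (rule Bochner_Integration.integrable_bound)
    show "integrable lborel (\<lambda>u. B n * p u)"
      using that by simp
    show "(\<lambda>u. h n u * p u) \<in> borel_measurable lborel"
      using that by measurable
    show "AE u in lborel. norm (h n u * p u) \<le> norm (B n * p u)"
      using h_nonneg[of n] h_bound[of n]
      by (intro AE_I2) (auto simp: abs_mult intro!: mult_right_mono order_trans[OF h_bound abs_ge_self])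
  qed
  define C where "C = (\<integral>u. \<bar>w u\<bar> \<partial>lborel)"
  have C: "0 \<le> C"
    by (simp add: C_def)
  have "(\<lambda>n. \<integral>u. h n u * w u \<partial>lborel) \<longlonglongrightarrow> 0"
  proof (rule tendstoI)
    fix e :: real assume e: "0 < e"
    \<comment> \<open>The summand 1 keeps the denominator positive when \<open>C = 0\<close>, and
      \<open>c * C < e / 2\<close> still holds.\<close>
    define c where "c = e / (2 * (C + 1))"
    have c: "0 < c" "c * C < e / 2"
      using e C by (auto simp: c_def field_simps)
    \<comment> \<open>Near \<beta> the function \<open>w\<close> is compared with a multiple of
      \<open>g\<close> rather than with a constant, so that the unit mass of \<open>h n * g\<close>
      bounds this part of the integral by \<open>e / 2\<close>.\<close>
    have "eventually (\<lambda>u. \<bar>w u\<bar> - e / 2 * g u < 0) (nhds \<beta>)"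
    proof (rule order_tendstoD)
      show "((\<lambda>u. \<bar>w u\<bar> - e / 2 * g u) \<longlongrightarrow> \<bar>w \<beta>\<bar> - e / 2 * g \<beta>) (nhds \<beta>)"
        using w_cont g(3) by (intro tendsto_intros) (auto simp: isCont_def tendsto_at_iff_tendsto_nhds)
      show "\<bar>w \<beta>\<bar> - e / 2 * g \<beta> < 0"
        using e g by (simp add: w_\<beta>)
    qed
    then obtain \<delta> where \<delta>: "0 < \<delta>" "\<And>u. \<bar>u - \<beta>\<bar> < \<delta> \<Longrightarrow> \<bar>w u\<bar> < e / 2 * g u"
      by (auto simp: eventually_nhds_metric dist_real_def)
    show "eventually (\<lambda>n. dist (\<integral>u. h n u * w u \<partial>lborel) 0 < e) sequentially"
      using mass uniform_limitD[OF away[OF \<delta>(1)] c(1)]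
    proof eventually_elim
      case (elim n)
      have bound: "\<bar>h n u * w u\<bar> \<le> e / 2 * (h n u * g u) + c * \<bar>w u\<bar>" for u
      proof (cases "\<bar>u - \<beta>\<bar> < \<delta>")
        case True
        then have "h n u * \<bar>w u\<bar> \<le> h n u * (e / 2 * g u)"
          using \<delta>(2) h_nonneg by (intro mult_left_mono) (auto intro: less_imp_le)
        moreover have "0 \<le> c * \<bar>w u\<bar>"
          using c by simp
        ultimately show ?thesis
          using h_nonneg[of n u] by (simp add: abs_mult algebra_simps)
      next
        case False
        then have "dist (h n u) 0 < c"
          using elim(2) by simp
        then have "h n u \<le> c"
          by (simp add: dist_real_def)
        then have "h n u * \<bar>w u\<bar> \<le> c * \<bar>w u\<bar>"
          by (intro mult_right_mono) auto
        moreover have "0 \<le> e / 2 * (h n u * g u)"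
          using e h_nonneg[of n u] g(2)[of u] by simp
        ultimately show ?thesis
          using h_nonneg[of n u] by (simp add: abs_mult)
      qed
      have "\<bar>\<integral>u. h n u * w u \<partial>lborel\<bar> \<le> (\<integral>u. \<bar>h n u * w u\<bar> \<partial>lborel)"
        by (rule integral_abs_bound)
      also have "\<dots> \<le> (\<integral>u. e / 2 * (h n u * g u) + c * \<bar>w u\<bar> \<partial>lborel)"
        using bound w_int g(1) h_int by (intro integral_mono) auto
      also have "\<dots> = e / 2 * (\<integral>u. h n u * g u \<partial>lborel) + c * C"
        unfolding C_def using w_int g(1) h_int by (subst Bochner_Integration.integral_add) auto
      also have "\<dots> < e"
        using elim(1) c by simp
      finally show ?case
        by (simp add: dist_real_def)
    qed
  qed
  then have "(\<lambda>n. (\<integral>u. h n u * w u \<partial>lborel) + r) \<longlonglongrightarrow> 0 + r"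
    by (intro tendsto_intros)
  \<comment> \<open>The unit mass turns the subtracted multiple of \<open>g\<close> into the
    constant \<open>r\<close>.\<close>
  moreover have "eventually (\<lambda>n. (\<integral>u. h n u * w u \<partial>lborel) + r = (\<integral>u. h n u * q u \<partial>lborel)) sequentially"
    using mass
  proof eventually_elim
    case (elim n)
    have "(\<integral>u. h n u * w u \<partial>lborel) = (\<integral>u. h n u * q u - r * (h n u * g u) \<partial>lborel)"
      by (simp add: w_def algebra_simps)
    also have "\<dots> = (\<integral>u. h n u * q u \<partial>lborel) - r * 1"
      using elim h_int g q by (subst Bochner_Integration.integral_diff) auto
    finally show ?case by simp
  qed
  ultimately show ?thesis
    unfolding r_def by (simp add: tendsto_cong)
qed

subsection \<open>The value attached to an order statistic of independent pairs\<close>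

text \<open>The product indexed by \<open>S\<close> is 1 exactly when \<open>S\<close> is the set of
  indices satisfying \<open>P\<close>, so at most one summand survives. In this form the indicator
  of a count is visibly measurable, and its integral over a product measure factorises.\<close>

lemma of_bool_card_filter_eq_sum:
  fixes I :: "'i set"
  assumes "finite I"
  shows "(of_bool (card {i\<in>I. P i} = a) :: 'a::comm_semiring_1) =
    (\<Sum>S | S \<subseteq> I \<and> card S = a. \<Prod>i\<in>I. of_bool (i \<in> S \<longleftrightarrow> P i))"
proof -
  have "(\<Prod>i\<in>I. of_bool (i \<in> S \<longleftrightarrow> P i)) = (of_bool (S = {i\<in>I. P i}) :: 'a)" if "S \<subseteq> I" for S
  proof (cases "S = {i\<in>I. P i}")
    case False
    then obtain i where "i \<in> I" "\<not> (i \<in> S \<longleftrightarrow> P i)"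
      using \<open>S \<subseteq> I\<close> by blast
    then have "(\<Prod>i\<in>I. of_bool (i \<in> S \<longleftrightarrow> P i)) = (0 :: 'a)"
      by (intro prod_zero) (use assms in auto)
    with False show ?thesis by simp
  qed (auto intro!: prod.neutral)
  then have "(\<Sum>S | S \<subseteq> I \<and> card S = a. \<Prod>i\<in>I. of_bool (i \<in> S \<longleftrightarrow> P i))
      = (\<Sum>S | S \<subseteq> I \<and> card S = a. of_bool (S = {i\<in>I. P i}) :: 'a)"
    by (intro sum.cong) auto
  also have "\<dots> = of_bool (card {i\<in>I. P i} = a)"
    unfolding of_bool_def using assms by (subst sum.delta) auto
  finally show ?thesis ..
qed

text \<open>Given \<open>v j = z\<close>, the other coordinates fall below \<open>snd z\<close>
  independently with the same probability, so their number is binomial with \<open>card I\<close>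
  trials.\<close>

lemma nn_integral_PiM_rank:
  fixes K :: "('b \<times> real) measure" and I :: "'i set"
  assumes "prob_space K" and sets_K [measurable_cong]: "sets K = sets (N \<Otimes>\<^sub>M borel)"
    and I: "finite I" "j \<notin> I" and A [measurable]: "A \<in> sets N"
  shows "(\<integral>\<^sup>+v. indicator A (fst (v j)) * of_bool (card {i\<in>I. snd (v i) < snd (v j)} = a)
        \<partial>Pi\<^sub>M (insert j I) (\<lambda>_. K)) =
    (\<integral>\<^sup>+z. indicator A (fst z) * ennreal (real (card I choose a)
        * measure K {w\<in>space K. snd w < snd z} ^ a
        * (1 - measure K {w\<in>space K. snd w < snd z}) ^ (card I - a)) \<partial>K)"
proof -
  interpret prob_space K by fact
  interpret product_sigma_finite "\<lambda>_. K" ..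
  \<comment> \<open>For a fixed threshold \<open>u\<close>: each subset of size \<open>a\<close>
    contributes the same product of probabilities, and there are \<open>card I choose a\<close> of
    them.\<close>
  have inner: "(\<integral>\<^sup>+x. of_bool (card {i\<in>I. snd (x i) < u} = a) \<partial>Pi\<^sub>M I (\<lambda>_. K)) =
      ennreal (real (card I choose a) * measure K {w\<in>space K. snd w < u} ^ a
        * (1 - measure K {w\<in>space K. snd w < u}) ^ (card I - a))" for u
  proof -
    define p where "p = measure K {w\<in>space K. snd w < u}"
    have p: "0 \<le> p" "p \<le> 1"
      by (auto simp: p_def)
    have less: "emeasure K {w\<in>space K. snd w < u} = ennreal p"
      by (simp add: p_def emeasure_eq_measure)
    have not_less: "emeasure K {w\<in>space K. \<not> snd w < u} = ennreal (1 - p)"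
      unfolding p_def emeasure_eq_measure by (subst prob_neg) auto
    have factor: "(\<integral>\<^sup>+w. of_bool (b \<longleftrightarrow> snd w < u) \<partial>K) = (if b then ennreal p else ennreal (1 - p))" for b
    proof -
      have "(\<integral>\<^sup>+w. of_bool (b \<longleftrightarrow> snd w < u) \<partial>K) = (\<integral>\<^sup>+w. indicator {w\<in>space K. b \<longleftrightarrow> snd w < u} w \<partial>K)"
        by (intro nn_integral_cong) (auto split: split_indicator)
      also have "\<dots> = emeasure K {w\<in>space K. b \<longleftrightarrow> snd w < u}"
        by (intro nn_integral_indicator) measurable
      finally show ?thesis
        using less not_less by auto
    qed
    have "(\<integral>\<^sup>+x. of_bool (card {i\<in>I. snd (x i) < u} = a) \<partial>Pi\<^sub>M I (\<lambda>_. K)) =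
        (\<Sum>S | S \<subseteq> I \<and> card S = a. \<integral>\<^sup>+x. (\<Prod>i\<in>I. of_bool (i \<in> S \<longleftrightarrow> snd (x i) < u)) \<partial>Pi\<^sub>M I (\<lambda>_. K))"
      unfolding of_bool_card_filter_eq_sum[OF I(1)]
      by (intro nn_integral_sum borel_measurable_prod) measurable
    also have "\<dots> = (\<Sum>S | S \<subseteq> I \<and> card S = a. \<Prod>i\<in>I. \<integral>\<^sup>+w. of_bool (i \<in> S \<longleftrightarrow> snd w < u) \<partial>K)"
      by (intro sum.cong refl product_nn_integral_prod I) measurable
    also have "\<dots> = (\<Sum>S | S \<subseteq> I \<and> card S = a. ennreal (p ^ a * (1 - p) ^ (card I - a)))"
    proof (intro sum.cong refl)
      fix S assume "S \<in> {S. S \<subseteq> I \<and> card S = a}"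
      then have S: "S \<subseteq> I" "card S = a" by auto
      have "(\<Prod>i\<in>I. \<integral>\<^sup>+w. of_bool (i \<in> S \<longleftrightarrow> snd w < u) \<partial>K)
          = (\<Prod>i\<in>I. if i \<in> S then ennreal p else ennreal (1 - p))"
        by (simp add: factor)
      also have "\<dots> = ennreal p ^ card S * ennreal (1 - p) ^ card (I - S)"
        using I S by (simp add: prod.If_cases Int_absorb1 Diff_eq)
      also have "\<dots> = ennreal (p ^ a * (1 - p) ^ (card I - a))"
        using I S p by (simp add: card_Diff_subset finite_subset ennreal_power ennreal_mult)
      finally show "(\<Prod>i\<in>I. \<integral>\<^sup>+w. of_bool (i \<in> S \<longleftrightarrow> snd w < u) \<partial>K) = ennreal (p ^ a * (1 - p) ^ (card I - a))" .
    qed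
    also have "\<dots> = of_nat (card I choose a) * ennreal (p ^ a * (1 - p) ^ (card I - a))"
      by (simp add: n_subsets I)
    also have "\<dots> = ennreal (real (card I choose a) * (p ^ a * (1 - p) ^ (card I - a)))"
      using p by (subst ennreal_mult) (auto simp: ennreal_of_nat_eq_real_of_nat)
    finally show ?thesis
      by (simp add: p_def mult.assoc)
  qed
  \<comment> \<open>Fubini with coordinate \<open>j\<close> outermost, so that the inner integral
    sees a constant threshold.\<close>
  have "(\<integral>\<^sup>+v. indicator A (fst (v j)) * of_bool (card {i\<in>I. snd (v i) < snd (v j)} = a)
        \<partial>Pi\<^sub>M (insert j I) (\<lambda>_. K)) =
      (\<integral>\<^sup>+z. \<integral>\<^sup>+x. indicator A (fst ((x(j := z)) j))
        * of_bool (card {i\<in>I. snd ((x(j := z)) i) < snd ((x(j := z)) j)} = a) \<partial>Pi\<^sub>M I (\<lambda>_. K) \<partial>K)"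
    using I unfolding of_bool_card_filter_eq_sum[OF I(1)]
    by (subst product_nn_integral_insert_rev) (auto intro!: borel_measurable_sum borel_measurable_prod)
  also have "\<dots> = (\<integral>\<^sup>+z. \<integral>\<^sup>+x. indicator A (fst z)
        * of_bool (card {i\<in>I. snd (x i) < snd z} = a) \<partial>Pi\<^sub>M I (\<lambda>_. K) \<partial>K)"
  proof -
    have upd: "{i\<in>I. snd ((x(j := z)) i) < snd z} = {i\<in>I. snd (x i) < snd z}"
      for x :: "'i \<Rightarrow> 'b \<times> real" and z
      using I by auto
    show ?thesis
      unfolding fun_upd_same upd ..
  qed
  also have "\<dots> = (\<integral>\<^sup>+z. indicator A (fst z) * (\<integral>\<^sup>+x.
        of_bool (card {i\<in>I. snd (x i) < snd z} = a) \<partial>Pi\<^sub>M I (\<lambda>_. K)) \<partial>K)"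
    unfolding of_bool_card_filter_eq_sum[OF I(1)]
    by (intro nn_integral_cong nn_integral_cmult borel_measurable_sum borel_measurable_prod) measurable
  finally show ?thesis
    unfolding inner .
qed

text \<open>A tie between two coordinates is null: with all coordinates but one fixed, the remaining
  one must hit a prescribed value. There are only finitely many pairs.\<close>

lemma AE_PiM_inj_on:
  fixes K :: "('b \<times> real) measure" and J :: "'i set"
  assumes "prob_space K" and sets_K [measurable_cong]: "sets K = sets (N \<Otimes>\<^sub>M borel)"
    and J: "finite J" and null: "\<And>u. emeasure K {w\<in>space K. snd w = u} = 0"
  shows "AE v in Pi\<^sub>M J (\<lambda>_. K). inj_on (\<lambda>i. snd (v i)) J"
proof -
  interpret prob_space K by fact
  interpret product_sigma_finite "\<lambda>_. K" ..
  have "AE v in Pi\<^sub>M J (\<lambda>_. K). snd (v i) \<noteq> snd (v j)" if ij: "i \<in> J" "j \<in> J" "i \<noteq> j" for i j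
  proof -
    define I where "I = J - {j}"
    have I: "finite I" "j \<notin> I" "J = insert j I" "i \<in> I"
      using ij J by (auto simp: I_def)
    have [measurable]: "{v\<in>space (Pi\<^sub>M J (\<lambda>_. K)). snd (v i) = snd (v j)} \<in> sets (Pi\<^sub>M J (\<lambda>_. K))"
      using ij by measurable
    have meas: "(\<lambda>v. of_bool (snd (v i) = snd (v j)) :: ennreal) \<in> borel_measurable (Pi\<^sub>M J (\<lambda>_. K))"
      using ij by measurable
    have "emeasure (Pi\<^sub>M J (\<lambda>_. K)) {v\<in>space (Pi\<^sub>M J (\<lambda>_. K)). snd (v i) = snd (v j)}
        = (\<integral>\<^sup>+v. indicator {v\<in>space (Pi\<^sub>M J (\<lambda>_. K)). snd (v i) = snd (v j)} v \<partial>Pi\<^sub>M J (\<lambda>_. K))"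
      by simp
    also have "\<dots> = (\<integral>\<^sup>+v. of_bool (snd (v i) = snd (v j)) \<partial>Pi\<^sub>M J (\<lambda>_. K))"
      by (intro nn_integral_cong) (auto split: split_indicator)
    also have "\<dots> = (\<integral>\<^sup>+x. \<integral>\<^sup>+z. of_bool (snd ((x(j := z)) i) = snd ((x(j := z)) j)) \<partial>K \<partial>Pi\<^sub>M I (\<lambda>_. K))"
      using meas unfolding I(3) by (rule product_nn_integral_insert[OF I(1,2)])
    also have "\<dots> = (\<integral>\<^sup>+x. \<integral>\<^sup>+z. indicator {w\<in>space K. snd w = snd (x i)} z \<partial>K \<partial>Pi\<^sub>M I (\<lambda>_. K))"
      using ij by (intro nn_integral_cong) (auto split: split_indicator)
    also have "\<dots> = 0"
      by (simp add: null)
    finally show ?thesis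
      by (subst AE_iff_measurable[OF _ refl]) auto
  qed
  then have "AE v in Pi\<^sub>M J (\<lambda>_. K). \<forall>i\<in>J. \<forall>j\<in>J. i \<noteq> j \<longrightarrow> snd (v i) \<noteq> snd (v j)"
    using J by (intro AE_finite_allI) auto
  then show ?thesis
    by eventually_elim (auto intro!: inj_onI)
qed

text \<open>The integrand on the left tests the concomitant of the order statistic, that is, the
  first component of the pair whose second component has rank \<open>k\<close>. Splitting by the
  index of this pair gives \<open>n\<close> equal terms, which account for the factor
  \<open>n\<close> in the kernel.\<close>

lemma (in prob_space) nn_integral_order_stat_concomitant:
  fixes V :: "nat \<Rightarrow> 'a \<Rightarrow> 'b \<times> real"
  assumes k: "1 \<le> k" "k \<le> n"
    and indep: "indep_vars (\<lambda>_. N \<Otimes>\<^sub>M borel) V {1..n}"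
    and distr: "\<And>j. j \<in> {1..n} \<Longrightarrow> distr M (N \<Otimes>\<^sub>M borel) (V j) = K"
    and null: "\<And>u. emeasure K {w\<in>space K. snd w = u} = 0"
    and A [measurable]: "A \<in> sets N"
  shows "(\<integral>\<^sup>+\<omega>. indicator A (fst (V (order_stat_index n k (\<lambda>i. snd (V i \<omega>))) \<omega>)) \<partial>M) =
    (\<integral>\<^sup>+z. indicator A (fst z) * ennreal (order_stat_kernel n k (measure K {w\<in>space K. snd w < snd z})) \<partial>K)"
proof -
  define J where "J = {1..n}"
  define W where "W = (\<lambda>\<omega>. \<lambda>i\<in>J. V i \<omega>)"
  define rk where "rk = (\<lambda>j v. card {i\<in>J - {j}. snd (v i :: 'b \<times> real) < snd (v j)})"
  have J: "finite J" "J \<noteq> {}" "card J = n"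
    using k by (auto simp: J_def)
  have rv [measurable]: "V i \<in> M \<rightarrow>\<^sub>M N \<Otimes>\<^sub>M borel" if "i \<in> J" for i
    using indep that by (auto simp: indep_vars_def J_def)
  have K_eq: "K = distr M (N \<Otimes>\<^sub>M borel) (V 1)"
    using distr[of 1] k by simp
  interpret K: prob_space K
    unfolding K_eq using J k by (intro prob_space_distr rv) (auto simp: J_def)
  have sets_K [measurable_cong]: "sets K = sets (N \<Otimes>\<^sub>M borel)"
    by (simp add: K_eq)
  have W: "W \<in> M \<rightarrow>\<^sub>M Pi\<^sub>M J (\<lambda>_. N \<Otimes>\<^sub>M borel)"
    unfolding W_def by (intro measurable_restrict) auto
  \<comment> \<open>Independence together with the common law \<open>K\<close> makes the joint law a
    power of \<open>K\<close>.\<close>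
  have law: "distr M (Pi\<^sub>M J (\<lambda>_. N \<Otimes>\<^sub>M borel)) W = Pi\<^sub>M J (\<lambda>_. K)"
  proof -
    have "distr M (Pi\<^sub>M J (\<lambda>_. N \<Otimes>\<^sub>M borel)) W = (\<Pi>\<^sub>M i\<in>J. distr M (N \<Otimes>\<^sub>M borel) (V i))"
      unfolding W_def using J indep rv by (subst indep_vars_iff_distr_eq_PiM'[symmetric]) (auto simp: J_def)
    also have "\<dots> = Pi\<^sub>M J (\<lambda>_. K)"
      by (intro PiM_cong) (auto simp: distr J_def)
    finally show ?thesis .
  qed
  have "AE v in distr M (Pi\<^sub>M J (\<lambda>_. N \<Otimes>\<^sub>M borel)) W. inj_on (\<lambda>i. snd (v i)) J"
    unfolding law by (rule AE_PiM_inj_on[OF K.prob_space_axioms sets_K J(1) null])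
  then have "AE \<omega> in M. inj_on (\<lambda>i. snd (W \<omega> i)) J"
    using W by (rule AE_distrD[rotated])
  moreover have "inj_on (\<lambda>i. snd (W \<omega> i)) J \<longleftrightarrow> inj_on (\<lambda>i. snd (V i \<omega>)) {1..n}" for \<omega>
    unfolding J_def[symmetric] by (rule inj_on_cong) (simp add: W_def)
  ultimately have inj: "AE \<omega> in M. inj_on (\<lambda>i. snd (V i \<omega>)) {1..n}"
    by simp
  have rk_measurable [measurable]:
    "(\<lambda>v. indicator A (fst (v j)) * of_bool (rk j v = a) :: ennreal) \<in> borel_measurable (Pi\<^sub>M J (\<lambda>_. N \<Otimes>\<^sub>M borel))"
    if "j \<in> J" for j a
  proof -
    have "finite (J - {j})" using J by simp
    then show ?thesis
      unfolding rk_def of_bool_card_filter_eq_sum[OF \<open>finite (J - {j})\<close>] using that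
      by (intro borel_measurable_times_ennreal borel_measurable_sum borel_measurable_prod) auto
  qed
  \<comment> \<open>Outside the null set of ties exactly one \<open>j\<close> has rank
    \<open>k - 1\<close>, so the sum over \<open>j\<close> reproduces the value at the random
    index.\<close>
  have "(\<integral>\<^sup>+\<omega>. indicator A (fst (V (order_stat_index n k (\<lambda>i. snd (V i \<omega>))) \<omega>)) \<partial>M) =
      (\<integral>\<^sup>+\<omega>. (\<Sum>j\<in>J. indicator A (fst (W \<omega> j)) * of_bool (rk j (W \<omega>) = k - 1)) \<partial>M)"
  proof (rule nn_integral_cong_AE, use inj in eventually_elim)
    case (elim \<omega>)
    let ?i = "order_stat_index n k (\<lambda>i. snd (V i \<omega>))"
    have i: "?i \<in> J"
      using order_stat_index_in[OF k] by (simp add: J_def)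
    have "rk j (W \<omega>) = k - 1 \<longleftrightarrow> ?i = j" if "j \<in> J" for j
    proof -
      have "{i\<in>J - {j}. snd (W \<omega> i) < snd (W \<omega> j)} = {i\<in>{1..n} - {j}. snd (V i \<omega>) < snd (V j \<omega>)}"
        using that by (auto simp: W_def J_def)
      then show ?thesis
        using order_stat_index_eq_iff[OF elim k, of j] that by (simp add: rk_def J_def)
    qed
    then have "(\<Sum>j\<in>J. indicator A (fst (W \<omega> j)) * of_bool (rk j (W \<omega>) = k - 1))
        = (\<Sum>j\<in>J. if ?i = j then indicator A (fst (V j \<omega>)) else (0::ennreal))"
      by (intro sum.cong) (auto simp: W_def)
    also have "\<dots> = indicator A (fst (V ?i \<omega>))"
      using J i by simp
    finally show ?case ..
  qed
  also have "\<dots> = (\<integral>\<^sup>+v. (\<Sum>j\<in>J. indicator A (fst (v j)) * of_bool (rk j v = k - 1)) \<partial>Pi\<^sub>M J (\<lambda>_. K))"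
    unfolding law[symmetric] by (subst nn_integral_distr[OF W]) (auto intro!: borel_measurable_sum)
  also have "\<dots> = (\<Sum>j\<in>J. \<integral>\<^sup>+v. indicator A (fst (v j)) * of_bool (rk j v = k - 1) \<partial>Pi\<^sub>M J (\<lambda>_. K))"
    unfolding law[symmetric] by (intro nn_integral_sum) auto
  also have "\<dots> = (\<Sum>j\<in>J. \<integral>\<^sup>+z. indicator A (fst z) * ennreal (real (n - 1 choose (k - 1))
        * measure K {w\<in>space K. snd w < snd z} ^ (k - 1)
        * (1 - measure K {w\<in>space K. snd w < snd z}) ^ (n - k)) \<partial>K)"
  proof (intro sum.cong refl)
    fix j assume "j \<in> J"
    then have "insert j (J - {j}) = J" "card (J - {j}) = n - 1"
      using J by auto
    then show "(\<integral>\<^sup>+v. indicator A (fst (v j)) * of_bool (rk j v = k - 1) \<partial>Pi\<^sub>M J (\<lambda>_. K)) =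
        (\<integral>\<^sup>+z. indicator A (fst z) * ennreal (real (n - 1 choose (k - 1))
        * measure K {w\<in>space K. snd w < snd z} ^ (k - 1)
        * (1 - measure K {w\<in>space K. snd w < snd z}) ^ (n - k)) \<partial>K)"
      using nn_integral_PiM_rank[OF K.prob_space_axioms sets_K, of "J - {j}" j A "k - 1"] J k
      by (simp add: rk_def)
  qed
  \<comment> \<open>The summands no longer depend on \<open>j\<close>; they are collected into the
    factor \<open>n\<close>, which moves inside the integral.\<close>
  also have "\<dots> = (\<integral>\<^sup>+z. ennreal n * (indicator A (fst z) * ennreal (real (n - 1 choose (k - 1))
        * measure K {w\<in>space K. snd w < snd z} ^ (k - 1)
        * (1 - measure K {w\<in>space K. snd w < snd z}) ^ (n - k))) \<partial>K)"
  proof -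
    have "(\<lambda>u. measure K {w\<in>space K. snd w < u}) \<in> borel_measurable borel"
      by (intro borel_measurable_mono monoI K.finite_measure_mono) auto
    then show ?thesis
      by (subst nn_integral_cmult) (auto simp: J ennreal_of_nat_eq_real_of_nat)
  qed
  also have "\<dots> = (\<integral>\<^sup>+z. indicator A (fst z) *
      ennreal (order_stat_kernel n k (measure K {w\<in>space K. snd w < snd z})) \<partial>K)"
    unfolding order_stat_kernel_def
    by (intro nn_integral_cong) (auto simp: ennreal_mult' split: split_indicator)
  finally show ?thesis .
qed

subsection \<open>The distribution of the first factor\<close>

lemma has_density_integrable:
  assumes "prob_space M" "has_density M X f"
  shows "integrable lborel f"
proof -
  interpret prob_space M by fact
  have D: "distributed M lborel X (\<lambda>x. ennreal (f x))" and f: "\<And>x. 0 \<le> f x"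
    using assms by (auto simp: has_density_def)
  have [measurable]: "f \<in> borel_measurable lborel"
    using distributed_real_measurable[OF _ D] f by auto
  have "(\<integral>\<^sup>+x. ennreal (f x) \<partial>lborel) = 1"
    using distributed_nn_integral[OF D, of "\<lambda>_. 1"] by (simp add: emeasure_space_1)
  then show ?thesis
    using f by (intro integrableI_nonneg) auto
qed

lemma has_density_singleton:
  assumes "has_density M X f"
  shows "emeasure M {\<omega>\<in>space M. X \<omega> = u} = 0"
proof -
  have "emeasure M (X -` {u} \<inter> space M) = (\<integral>\<^sup>+x. ennreal (f x) * indicator {u} x \<partial>lborel)"
    using assms by (intro distributed_emeasure) (auto simp: has_density_def)
  also have "\<dots> = (\<integral>\<^sup>+x. 0 \<partial>(lborel :: real measure))"
    by (intro nn_integral_cong_AE eventually_mono[OF AE_lborel_singleton[of u]]) auto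
  finally show ?thesis
    by (simp add: vimage_def Int_def conj_commute)
qed

text \<open>The concomitant formula is applied to the pairs formed by the first factor and the
  product. They are independent with equal laws because each is the image of one copied vector under
  the same measurable map.\<close>

lemma nn_integral_first_factor:
  fixes X :: "nat \<Rightarrow> 'a \<Rightarrow> real"
  assumes m: "1 \<le> m" and M: "prob_space M" and X: "prob_space.indep_vars M (\<lambda>_. borel) X {1..m}"
    and g: "has_density M (\<lambda>\<omega>. \<Prod>i=1..m. X i \<omega>) g"
    and copies: "indep_copies M m X n N Z" and k: "1 \<le> k" "k \<le> n" and A [measurable]: "A \<in> sets borel"
  defines "G \<equiv> cdf (distr M borel (\<lambda>\<omega>. \<Prod>i=1..m. X i \<omega>))"
  shows "(\<integral>\<^sup>+\<omega>. indicator A (first_factor m n k Z \<omega>) \<partial>N) =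
    (\<integral>\<^sup>+\<omega>. indicator A (X 1 \<omega>) * ennreal (order_stat_kernel n k (G (\<Prod>i=1..m. X i \<omega>))) \<partial>M)"
proof -
  interpret prob_space M by fact
  interpret N: prob_space N
    using copies by (simp add: indep_copies_def)
  define \<phi> where "\<phi> = (\<lambda>v :: nat \<Rightarrow> real. (v 1, \<Prod>i=1..m. v i))"
  define K where "K = distr M (borel \<Otimes>\<^sub>M borel) (\<lambda>\<omega>. (X 1 \<omega>, \<Prod>i=1..m. X i \<omega>))"
  define V where "V = (\<lambda>j \<omega>. \<phi> (\<lambda>i\<in>{1..m}. Z j i \<omega>))"
  have \<phi>: "\<phi> \<in> Pi\<^sub>M {1..m} (\<lambda>_. borel) \<rightarrow>\<^sub>M borel \<Otimes>\<^sub>M borel"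
    unfolding \<phi>_def by measurable (use m in auto)
  have [measurable]: "X i \<in> borel_measurable M" if "i \<in> {1..m}" for i
    using X that by (auto simp: indep_vars_def)
  have one: "1 \<in> {1..m}" using m by simp
  have [measurable]: "X 1 \<in> borel_measurable M"
    using one by measurable
  have prod_meas [measurable]: "(\<lambda>\<omega>. \<Prod>i=1..m. X i \<omega>) \<in> borel_measurable M"
    by (intro borel_measurable_prod) auto
  have indep_V: "N.indep_vars (\<lambda>_. borel \<Otimes>\<^sub>M borel) V {1..n}"
    unfolding V_def using copies by (intro N.indep_vars_compose2[OF _ \<phi>]) (auto simp: indep_copies_def)
  have distr_V: "distr N (borel \<Otimes>\<^sub>M borel) (V j) = K" if j: "j \<in> {1..n}" for j
  proof -
    have meas_Z: "(\<lambda>\<omega>. \<lambda>i\<in>{1..m}. Z j i \<omega>) \<in> N \<rightarrow>\<^sub>M Pi\<^sub>M {1..m} (\<lambda>_. borel)"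
      using copies j by (auto simp: indep_copies_def N.indep_vars_def)
    have meas_X: "(\<lambda>\<omega>. \<lambda>i\<in>{1..m}. X i \<omega>) \<in> M \<rightarrow>\<^sub>M Pi\<^sub>M {1..m} (\<lambda>_. borel)"
      by (intro measurable_restrict) auto
    have "distr N (borel \<Otimes>\<^sub>M borel) (V j)
        = distr (distr N (Pi\<^sub>M {1..m} (\<lambda>_. borel)) (\<lambda>\<omega>. \<lambda>i\<in>{1..m}. Z j i \<omega>)) (borel \<Otimes>\<^sub>M borel) \<phi>"
      unfolding distr_distr[OF \<phi> meas_Z] by (simp only: V_def comp_def)
    also have "\<dots> = distr (distr M (Pi\<^sub>M {1..m} (\<lambda>_. borel)) (\<lambda>\<omega>. \<lambda>i\<in>{1..m}. X i \<omega>)) (borel \<Otimes>\<^sub>M borel) \<phi>"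
      using copies j by (simp add: indep_copies_def)
    also have "\<dots> = K"
      unfolding distr_distr[OF \<phi> meas_X] K_def using one by (simp add: comp_def \<phi>_def)
    finally show ?thesis .
  qed
  have null_M: "emeasure M {\<omega>\<in>space M. (\<Prod>i=1..m. X i \<omega>) = u} = 0" for u
    by (rule has_density_singleton[OF g])
  have pair: "(\<lambda>\<omega>. (X 1 \<omega>, \<Prod>i=1..m. X i \<omega>)) \<in> M \<rightarrow>\<^sub>M borel \<Otimes>\<^sub>M borel"
    by measurable
  have sets_K [measurable_cong]: "sets K = sets (borel \<Otimes>\<^sub>M borel)"
    by (simp add: K_def)
  have null: "emeasure K {w\<in>space K. snd w = u} = 0" for u
  proof -
    have "{w\<in>space K. snd w = u} \<in> sets (borel \<Otimes>\<^sub>M borel)"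
      unfolding sets_K[symmetric] by measurable
    then show ?thesis
      using null_M[of u] unfolding K_def
      by (subst emeasure_distr[OF pair]) (auto simp: vimage_def space_pair_measure Int_def conj_commute)
  qed
  \<comment> \<open>The kernel counts strict comparisons whereas a distribution function uses
    \<open>\<le>\<close>; the two agree because the product has a density and hence no
    atoms.\<close>
  have less: "measure K {w\<in>space K. snd w < u} = G u" for u
  proof -
    have "G u = prob {\<omega>\<in>space M. (\<Prod>i=1..m. X i \<omega>) \<le> u}"
      unfolding G_def cdf_def by (subst measure_distr) (auto simp: vimage_def Int_def conj_commute)
    also have "{\<omega>\<in>space M. (\<Prod>i=1..m. X i \<omega>) \<le> u}
        = {\<omega>\<in>space M. (\<Prod>i=1..m. X i \<omega>) < u} \<union> {\<omega>\<in>space M. (\<Prod>i=1..m. X i \<omega>) = u}"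
      by auto
    also have "prob \<dots> = prob {\<omega>\<in>space M. (\<Prod>i=1..m. X i \<omega>) < u}"
      using null_M[of u] by (intro measure_Un_null_set) (auto simp: null_sets_def)
    also have "\<dots> = measure K {w\<in>space K. snd w < u}"
    proof -
      have "{w\<in>space K. snd w < u} \<in> sets (borel \<Otimes>\<^sub>M borel)"
        unfolding sets_K[symmetric] by measurable
      then show ?thesis
        unfolding K_def
        by (subst measure_distr[OF pair]) (auto simp: vimage_def space_pair_measure Int_def conj_commute)
    qed
    finally show ?thesis ..
  qed
  have G_meas [measurable]: "G \<in> borel_measurable borel"
  proof (rule borel_measurable_mono, rule monoI)
    fix u v :: real assume "u \<le> v"
    have "prob_space (distr M borel (\<lambda>\<omega>. \<Prod>i=1..m. X i \<omega>))"
      by (rule prob_space_distr) measurable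
    then show "G u \<le> G v"
      unfolding G_def cdf_def using \<open>u \<le> v\<close>
      by (intro finite_measure.finite_measure_mono prob_space.finite_measure) auto
  qed
  have [measurable]: "(\<lambda>u. order_stat_kernel n k (G u)) \<in> borel_measurable borel"
    unfolding order_stat_kernel_def by measurable
  have "first_factor m n k Z \<omega> = fst (V (order_stat_index n k (\<lambda>i. snd (V i \<omega>))) \<omega>)" for \<omega>
    using one by (simp add: first_factor_def V_def \<phi>_def)
  then have "(\<integral>\<^sup>+\<omega>. indicator A (first_factor m n k Z \<omega>) \<partial>N) =
      (\<integral>\<^sup>+z. indicator A (fst z) * ennreal (order_stat_kernel n k (G (snd z))) \<partial>K)"
    using N.nn_integral_order_stat_concomitant[OF k indep_V distr_V null A] by (simp add: less)
  also have "\<dots> = (\<integral>\<^sup>+\<omega>. indicator A (X 1 \<omega>) * ennreal (order_stat_kernel n k (G (\<Prod>i=1..m. X i \<omega>))) \<partial>M)"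
    unfolding K_def by (subst nn_integral_distr[OF pair]) auto
  finally show ?thesis .
qed

section \<open>The distribution function of the product and its quantile\<close>

lemma has_density_real_distribution:
  assumes "prob_space M" "has_density M Y g"
  shows "real_distribution (distr M borel Y)"
  using assms by (intro prob_space.real_distribution_distr) (auto simp: has_density_def distributed_def)

text \<open>Without atoms the distribution function is continuous, and its limits 0 and 1 enclose
  \<eta>; the intermediate value theorem does the rest. This makes \<open>inv G_m \<eta>\<close> a
  genuine preimage.\<close>

lemma cdf_has_density_surj:
  assumes M: "prob_space M" and Y: "has_density M Y g" and \<eta>: "0 < \<eta>" "\<eta> < 1"
  shows "\<eta> \<in> range (cdf (distr M borel Y))"
proof -
  interpret real_distribution "distr M borel Y"
    by (rule has_density_real_distribution[OF M Y])
  let ?G = "cdf (distr M borel Y)"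
  have Y_meas: "Y \<in> borel_measurable M"
    using Y by (auto simp: has_density_def distributed_def)
  have cont: "isCont ?G u" for u
  proof -
    have "measure (distr M borel Y) {u} = measure M {\<omega>\<in>space M. Y \<omega> = u}"
      using Y_meas by (subst measure_distr) (auto simp: vimage_def Int_def conj_commute)
    then show ?thesis
      using has_density_singleton[OF Y, of u] by (simp add: isCont_cdf measure_def)
  qed
  have "eventually (\<lambda>u. ?G u < \<eta>) at_bot"
    using cdf_lim_at_bot \<eta>(1) by (rule order_tendstoD)
  then obtain a where a: "?G a < \<eta>"
    by (auto simp: eventually_at_bot_linorder)
  have "eventually (\<lambda>u. \<eta> < ?G u) at_top"
    using cdf_lim_at_top_prob \<eta>(2) by (rule order_tendstoD)
  then obtain b where b: "\<eta> < ?G b"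
    by (auto simp: eventually_at_top_linorder)
  have "a \<le> b"
    using a b cdf_nondecreasing[of b a] by linarith
  then obtain u where "?G u = \<eta>"
    using IVT[of ?G a \<eta> b] a b cont by auto
  then show ?thesis by auto
qed

text \<open>Near \<beta> the density exceeds \<open>g \<beta> / 2\<close>, so \<open>G\<close>
  changes by a fixed amount within a short interval on either side, and monotonicity keeps that gap
  further out. In particular \<open>G\<close> takes the value \<open>G \<beta>\<close> only at
  \<beta>, whichever preimage \<open>inv\<close> selects.\<close>

lemma cdf_has_density_separated:
  assumes M: "prob_space M" and Y: "has_density M Y g"
    and g: "isCont g \<beta>" "0 < g \<beta>" and \<delta>: "0 < \<delta>"
  defines "G \<equiv> cdf (distr M borel Y)"
  obtains \<epsilon> where "0 < \<epsilon>" "\<And>u. \<delta> \<le> \<bar>u - \<beta>\<bar> \<Longrightarrow> \<epsilon> \<le> \<bar>G u - G \<beta>\<bar>"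
proof -
  interpret real_distribution "distr M borel Y"
    by (rule has_density_real_distribution[OF M Y])
  have D: "distributed M lborel Y (\<lambda>x. ennreal (g x))"
    using Y by (simp add: has_density_def)
  then have Y_meas: "Y \<in> borel_measurable M"
    by (simp add: distributed_def)
  have "eventually (\<lambda>u. g \<beta> / 2 < g u) (nhds \<beta>)"
    using g by (intro order_tendstoD(1)[of g "g \<beta>"]) (auto simp: isCont_def tendsto_at_iff_tendsto_nhds)
  then obtain d where d: "0 < d" "\<And>u. \<bar>u - \<beta>\<bar> < d \<Longrightarrow> g \<beta> / 2 < g u"
    by (auto simp: eventually_nhds_metric dist_real_def)
  \<comment> \<open>With \<open>\<rho> \<le> \<delta>\<close> every point at distance at least
    \<delta> lies beyond \<open>\<beta> - \<rho>\<close> or \<open>\<beta> + \<rho>\<close>; with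
    \<open>\<rho> < d\<close> the lower bound on \<open>g\<close> holds in between.\<close>
  define \<rho> where "\<rho> = min \<delta> (d / 2)"
  have \<rho>: "0 < \<rho>" "\<rho> \<le> \<delta>" "\<rho> < d"
    using \<delta> d by (auto simp: \<rho>_def)
  have incr: "g \<beta> / 2 * (b - a) \<le> G b - G a" if ab: "\<beta> - \<rho> \<le> a" "a < b" "b \<le> \<beta> + \<rho>" for a b
  proof -
    have "ennreal (g \<beta> / 2 * (b - a)) = (\<integral>\<^sup>+u. ennreal (g \<beta> / 2) * indicator {a<..b} u \<partial>lborel)"
      using ab g by (subst ennreal_mult) (auto simp: nn_integral_cmult_indicator)
    also have "\<dots> \<le> (\<integral>\<^sup>+u. ennreal (g u) * indicator {a<..b} u \<partial>lborel)"
      using ab \<rho> by (intro nn_integral_mono) (auto split: split_indicator intro!: ennreal_leI less_imp_le[OF d(2)])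
    also have "\<dots> = emeasure M (Y -` {a<..b} \<inter> space M)"
      using D by (intro distributed_emeasure[symmetric]) auto
    also have "\<dots> = emeasure (distr M borel Y) {a<..b}"
      using Y_meas by (subst emeasure_distr) auto
    also have "\<dots> = ennreal (G b - G a)"
      using ab by (simp add: emeasure_Ioc G_def)
    finally show ?thesis
      using cdf_nondecreasing[of a b] ab by (simp add: G_def)
  qed
  show thesis
  proof (rule that[of "g \<beta> / 2 * \<rho>"])
    show "0 < g \<beta> / 2 * \<rho>"
      using g \<rho> by simp
    fix u assume "\<delta> \<le> \<bar>u - \<beta>\<bar>"
    then consider "\<beta> + \<rho> \<le> u" | "u \<le> \<beta> - \<rho>"
      using \<rho> by linarith
    then show "g \<beta> / 2 * \<rho> \<le> \<bar>G u - G \<beta>\<bar>"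
    proof cases
      case 1
      then have "G (\<beta> + \<rho>) \<le> G u"
        unfolding G_def by (rule cdf_nondecreasing)
      moreover have "g \<beta> / 2 * \<rho> \<le> G (\<beta> + \<rho>) - G \<beta>"
        using incr[of \<beta> "\<beta> + \<rho>"] \<rho> by simp
      ultimately show ?thesis by linarith
    next
      case 2
      then have "G u \<le> G (\<beta> - \<rho>)"
        unfolding G_def by (rule cdf_nondecreasing)
      moreover have "g \<beta> / 2 * \<rho> \<le> G \<beta> - G (\<beta> - \<rho>)"
        using incr[of "\<beta> - \<rho>" \<beta>] \<rho> by simp
      ultimately show ?thesis by linarith
    qed
  qed
qed

section \<open>The density of the first factor at finite sample size\<close>

lemma borel_measurable_order_stat_kernel_cdf:
  assumes "real_distribution D"
  shows "(\<lambda>u. order_stat_kernel n k (cdf D u)) \<in> borel_measurable borel"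
proof -
  interpret real_distribution D by fact
  have [measurable]: "cdf D \<in> borel_measurable borel"
    by (intro borel_measurable_mono monoI cdf_nondecreasing)
  show ?thesis
    unfolding order_stat_kernel_def by measurable
qed

text \<open>Total probability of the first factor; this replaces the substitution
  \<open>p = G u\<close> and a Beta integral.\<close>

lemma integral_order_stat_kernel_cdf:
  fixes X :: "nat \<Rightarrow> 'a \<Rightarrow> real"
  assumes m: "1 \<le> m" and M: "prob_space M" and X: "prob_space.indep_vars M (\<lambda>_. borel) X {1..m}"
    and g: "has_density M (\<lambda>\<omega>. \<Prod>i=1..m. X i \<omega>) g"
    and copies: "indep_copies M m X n N Z" and k: "1 \<le> k" "k \<le> n"
  defines "G \<equiv> cdf (distr M borel (\<lambda>\<omega>. \<Prod>i=1..m. X i \<omega>))"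
  shows "(\<integral>u. order_stat_kernel n k (G u) * g u \<partial>lborel) = 1"
proof -
  let ?Y = "\<lambda>\<omega>. \<Prod>i=1..m. X i \<omega>"
  interpret real_distribution "distr M borel ?Y"
    by (rule has_density_real_distribution[OF M g])
  interpret N: prob_space N
    using copies by (simp add: indep_copies_def)
  have D: "distributed M lborel ?Y (\<lambda>x. ennreal (g x))" and g_nonneg: "\<And>u. 0 \<le> g u"
    using g by (auto simp: has_density_def)
  have [measurable]: "g \<in> borel_measurable borel"
    using distributed_real_measurable[OF _ D] g_nonneg by auto
  have [measurable]: "(\<lambda>u. order_stat_kernel n k (G u)) \<in> borel_measurable borel"
    unfolding G_def by (rule borel_measurable_order_stat_kernel_cdf) standard
  have nonneg: "0 \<le> order_stat_kernel n k (G u)" for u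
    unfolding G_def by (intro order_stat_kernel_nonneg cdf_nonneg cdf_bounded_prob)
  have "1 = (\<integral>\<^sup>+\<omega>. indicator UNIV (first_factor m n k Z \<omega>) \<partial>N)"
    by (simp add: N.emeasure_space_1)
  also have "\<dots> = (\<integral>\<^sup>+\<omega>. ennreal (order_stat_kernel n k (G (?Y \<omega>))) \<partial>M)"
    using nn_integral_first_factor[OF m M X g copies k, of UNIV] by (simp add: G_def)
  also have "\<dots> = (\<integral>\<^sup>+u. ennreal (g u) * ennreal (order_stat_kernel n k (G u)) \<partial>lborel)"
    by (rule distributed_nn_integral[OF D, symmetric]) measurable
  also have "\<dots> = (\<integral>\<^sup>+u. ennreal (order_stat_kernel n k (G u) * g u) \<partial>lborel)"
    using nonneg g_nonneg by (intro nn_integral_cong) (simp add: ennreal_mult mult.commute)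
  finally have "(\<integral>\<^sup>+u. ennreal (order_stat_kernel n k (G u) * g u) \<partial>lborel) = 1" ..
  then show ?thesis
    using nonneg g_nonneg by (subst integral_eq_nn_integral) auto
qed

text \<open>The first factor is independent of the product of the others, so their joint density is
  a product. Integrating out the second variable \<open>t\<close>, with the whole product equal to
  \<open>x * t\<close>, leaves a density in \<open>x\<close>.\<close>

lemma first_factor_density_AE:
  fixes X :: "nat \<Rightarrow> 'a \<Rightarrow> real"
  assumes m: "1 \<le> m" and M: "prob_space M" and X: "prob_space.indep_vars M (\<lambda>_. borel) X {1..m}"
    and fX: "has_density M (X 1) fX"
    and g: "has_density M (\<lambda>\<omega>. \<Prod>i=1..m. X i \<omega>) g"
    and g_tail: "has_density M (\<lambda>\<omega>. \<Prod>i=2..m. X i \<omega>) g_tail"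
    and copies: "indep_copies M m X n N Z" and k: "1 \<le> k" "k \<le> n"
    and f: "has_density N (first_factor m n k Z) f"
  defines "G \<equiv> cdf (distr M borel (\<lambda>\<omega>. \<Prod>i=1..m. X i \<omega>))"
  shows "AE x in lborel. f x = fX x * (\<integral>t. g_tail t * order_stat_kernel n k (G (x * t)) \<partial>lborel)"
proof -
  let ?Y = "\<lambda>\<omega>. \<Prod>i=1..m. X i \<omega>" and ?T = "\<lambda>\<omega>. \<Prod>i=2..m. X i \<omega>"
  interpret prob_space M by fact
  interpret D: real_distribution "distr M borel ?Y"
    by (rule has_density_real_distribution[OF M g])
  interpret N: prob_space N
    using copies by (simp add: indep_copies_def)
  have DX: "distributed M lborel (X 1) (\<lambda>x. ennreal (fX x))" and fX_nonneg: "\<And>u. 0 \<le> fX u"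
    using fX by (auto simp: has_density_def)
  have DT: "distributed M lborel ?T (\<lambda>x. ennreal (g_tail x))" and tail_nonneg: "\<And>u. 0 \<le> g_tail u"
    using g_tail by (auto simp: has_density_def)
  have Df: "distributed N lborel (first_factor m n k Z) (\<lambda>x. ennreal (f x))" and f_nonneg: "\<And>u. 0 \<le> f u"
    using f by (auto simp: has_density_def)
  have [measurable]: "fX \<in> borel_measurable borel"
    using distributed_real_measurable[OF _ DX] fX_nonneg by auto
  have [measurable]: "g_tail \<in> borel_measurable borel"
    using distributed_real_measurable[OF _ DT] tail_nonneg by auto
  have kernel_meas [measurable]: "(\<lambda>u. order_stat_kernel n k (G u)) \<in> borel_measurable borel"
    unfolding G_def by (rule borel_measurable_order_stat_kernel_cdf) (rule D.real_distribution_axioms)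
  have nonneg: "0 \<le> order_stat_kernel n k (G u)" for u
    unfolding G_def by (intro order_stat_kernel_nonneg D.cdf_nonneg D.cdf_bounded_prob)
  have le: "order_stat_kernel n k (G u) \<le> real n * real (n - 1 choose (k - 1))" for u
    unfolding G_def by (intro order_stat_kernel_le D.cdf_nonneg D.cdf_bounded_prob)
  have split: "{1..m} = insert 1 {2..m}"
    using m by auto
  have Y_eq: "?Y \<omega> = X 1 \<omega> * ?T \<omega>" for \<omega>
    unfolding split by simp
  have "indep_var borel (X 1) borel ?T"
    using X unfolding split by (intro indep_vars_prod) auto
  then have indep: "indep_var lborel (X 1) lborel ?T"
    by (simp add: indep_var_eq)
  have DXT: "distributed M (lborel \<Otimes>\<^sub>M lborel) (\<lambda>\<omega>. (X 1 \<omega>, ?T \<omega>)) (\<lambda>(x, t). ennreal (fX x) * ennreal (g_tail t))"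
    by (rule distributed_joint_indep[OF _ _ DX DT indep]) standard+
  define I where "I = (\<lambda>x. \<integral>t. g_tail t * order_stat_kernel n k (G (x * t)) \<partial>lborel)"
  have I_nonneg: "0 \<le> I x" for x
    unfolding I_def using tail_nonneg nonneg by (intro integral_nonneg_AE) auto
  have [measurable]: "I \<in> borel_measurable borel"
    unfolding I_def by measurable
  \<comment> \<open>The kernel is bounded for fixed \<open>n\<close> and \<open>g_tail\<close> is
    integrable, so the nonnegative integral is finite and equals the real one.\<close>
  have inner: "(\<integral>\<^sup>+t. ennreal (g_tail t) * ennreal (order_stat_kernel n k (G (x * t))) \<partial>lborel) = ennreal (I x)" for x
  proof -
    have "integrable lborel (\<lambda>t. g_tail t * order_stat_kernel n k (G (x * t)))"
    proof (rule Bochner_Integration.integrable_bound)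
      show "integrable lborel (\<lambda>t. g_tail t * (real n * real (n - 1 choose (k - 1))))"
        using has_density_integrable[OF M g_tail] by simp
      show "AE t in lborel. norm (g_tail t * order_stat_kernel n k (G (x * t)))
          \<le> norm (g_tail t * (real n * real (n - 1 choose (k - 1))))"
        using tail_nonneg nonneg le by (intro AE_I2) (auto simp: abs_mult intro!: mult_left_mono)
    qed measurable
    then have "(\<integral>\<^sup>+t. ennreal (g_tail t * order_stat_kernel n k (G (x * t))) \<partial>lborel) = ennreal (I x)"
      unfolding I_def using tail_nonneg nonneg by (intro nn_integral_eq_integral) auto
    then show ?thesis
      using tail_nonneg nonneg by (simp add: ennreal_mult)
  qed
  have law: "emeasure (distr N lborel (first_factor m n k Z)) A
      = (\<integral>\<^sup>+x. ennreal (fX x * I x) * indicator A x \<partial>lborel)" if [measurable]: "A \<in> sets borel" for A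
  proof -
    have ff [measurable]: "first_factor m n k Z \<in> borel_measurable N"
      using Df by (simp add: distributed_def)
    have "emeasure (distr N lborel (first_factor m n k Z)) A
        = (\<integral>\<^sup>+x. indicator A x \<partial>distr N lborel (first_factor m n k Z))"
      by (subst nn_integral_indicator) auto
    also have "\<dots> = (\<integral>\<^sup>+\<omega>. indicator A (first_factor m n k Z \<omega>) \<partial>N)"
      by (subst nn_integral_distr) auto
    also have "\<dots> = (\<integral>\<^sup>+\<omega>. indicator A (X 1 \<omega>) * ennreal (order_stat_kernel n k (G (X 1 \<omega> * ?T \<omega>))) \<partial>M)"
      unfolding Y_eq[symmetric] G_def by (rule nn_integral_first_factor[OF m M X g copies k that])
    also have "\<dots> = (\<integral>\<^sup>+z. (\<lambda>(x, t). ennreal (fX x) * ennreal (g_tail t)) z *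
        (\<lambda>(x, t). indicator A x * ennreal (order_stat_kernel n k (G (x * t)))) z \<partial>(lborel \<Otimes>\<^sub>M lborel))"
      by (subst distributed_nn_integral[OF DXT]) auto
    also have "\<dots> = (\<integral>\<^sup>+x. \<integral>\<^sup>+t. (ennreal (fX x) * ennreal (g_tail t)) *
        (indicator A x * ennreal (order_stat_kernel n k (G (x * t)))) \<partial>lborel \<partial>lborel)"
      by (subst lborel.nn_integral_fst[symmetric]) auto
    also have "\<dots> = (\<integral>\<^sup>+x. ennreal (fX x * I x) * indicator A x \<partial>lborel)"
    proof (intro nn_integral_cong)
      fix x :: real
      have "(\<integral>\<^sup>+t. (ennreal (fX x) * ennreal (g_tail t)) *
            (indicator A x * ennreal (order_stat_kernel n k (G (x * t)))) \<partial>lborel)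
          = (\<integral>\<^sup>+t. (ennreal (fX x) * indicator A x) *
            (ennreal (g_tail t) * ennreal (order_stat_kernel n k (G (x * t)))) \<partial>lborel)"
        by (intro nn_integral_cong) (simp add: mult_ac)
      also have "\<dots> = (ennreal (fX x) * indicator A x) * ennreal (I x)"
        unfolding inner[symmetric] by (intro nn_integral_cmult) measurable
      also have "\<dots> = ennreal (fX x * I x) * indicator A x"
        using fX_nonneg I_nonneg by (simp add: ennreal_mult mult_ac)
      finally show "(\<integral>\<^sup>+t. (ennreal (fX x) * ennreal (g_tail t)) *
            (indicator A x * ennreal (order_stat_kernel n k (G (x * t)))) \<partial>lborel)
          = ennreal (fX x * I x) * indicator A x" .
    qed
    finally show ?thesis .
  qed
  have "distributed N lborel (first_factor m n k Z) (\<lambda>x. ennreal (fX x * I x))"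
    unfolding distributed_def
  proof (intro conjI)
    show "distr N lborel (first_factor m n k Z) = density lborel (\<lambda>x. ennreal (fX x * I x))"
      using law by (intro measure_eqI) (auto simp: emeasure_density)
    show "first_factor m n k Z \<in> N \<rightarrow>\<^sub>M lborel"
      using Df by (simp add: distributed_def)
  qed measurable
  \<comment> \<open>Two densities of one law agree almost everywhere; nonnegativity carries the
    equality from \<open>ennreal\<close> back to the reals.\<close>
  from N.distributed_unique[OF Df this] have "AE x in lborel. f x = fX x * I x"
    by eventually_elim (use f_nonneg fX_nonneg I_nonneg in simp)
  then show ?thesis
    unfolding I_def .
qed

section \<open>Passage to the limit\<close>

text \<open>Densities are fixed only up to null sets; the continuity assumptions give meaning to the
  point values \<open>g_m \<beta>\<close> and \<open>g_tail (\<beta> / x)\<close>. A single null set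
  of \<open>x\<close> serves the whole sequence.\<close>

theorem proposition4:
  fixes M :: "'a measure" and X :: "nat \<Rightarrow> 'a \<Rightarrow> real" and fX :: "nat \<Rightarrow> real \<Rightarrow> real"
    and g_m g_tail :: "real \<Rightarrow> real" and G_m :: "real \<Rightarrow> real"
    and N :: "nat \<Rightarrow> 'b measure" and Z :: "nat \<Rightarrow> nat \<Rightarrow> nat \<Rightarrow> 'b \<Rightarrow> real"
    and f :: "nat \<Rightarrow> nat \<Rightarrow> real \<Rightarrow> real" and k :: "nat \<Rightarrow> nat"
    and m :: nat and \<eta> \<beta> :: real
  assumes "m \<ge> 2"
    and "prob_space M"
    and "prob_space.indep_vars M (\<lambda>_. borel) X {1..m}"
    and "\<And>i. i \<in> {1..m} \<Longrightarrow> has_density M (X i) (fX i)"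
    and "bounded (range (fX 1))"
    and "has_density M (\<lambda>\<omega>. \<Prod>i=1..m. X i \<omega>) g_m"
    and "G_m = cdf (distr M borel (\<lambda>\<omega>. \<Prod>i=1..m. X i \<omega>))"
    and "has_density M (\<lambda>\<omega>. \<Prod>i=2..m. X i \<omega>) g_tail"
    and "\<And>n. n \<ge> 1 \<Longrightarrow> indep_copies M m X n (N n) (Z n)"
    and "\<And>n k. 1 \<le> k \<Longrightarrow> k \<le> n \<Longrightarrow> has_density (N n) (first_factor m n k (Z n)) (f n k)"
    and "0 < \<eta>" and "\<eta> < 1"
    and "(\<lambda>n. real (k n) / real n) \<longlonglongrightarrow> \<eta>"
    and "\<beta> = inv G_m \<eta>"
    and "isCont g_m \<beta>" and "g_m \<beta> > 0"
    and "AE x in lborel. isCont g_tail (\<beta> / x)"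
  shows "AE x in lborel.
    (\<lambda>n. f n (k n) x) \<longlonglongrightarrow> g_tail (\<beta> / x) / (g_m \<beta> * \<bar>x\<bar>) * fX 1 x"
proof -
  define D where "D = distr M borel (\<lambda>\<omega>. \<Prod>i=1..m. X i \<omega>)"
  have m: "1 \<le> m" using assms(1) by simp
  note M = assms(2) and X = assms(3) and fX = assms(4) and g_m = assms(6) and g_tail = assms(8)
    and copies = assms(9) and f = assms(10) and \<eta> = assms(11,12) and lim = assms(13)
  have G: "G_m = cdf D"
    using assms(7) by (simp add: D_def)
  interpret D: real_distribution D
    unfolding D_def by (rule has_density_real_distribution[OF M g_m])
  \<comment> \<open>\<open>G_m\<close> need not be injective, so \<open>inv\<close> only selects some preimage of \<open>\<eta>\<close>.\<close>
  have G_\<beta>: "G_m \<beta> = \<eta>"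
    unfolding assms(14) using cdf_has_density_surj[OF M g_m \<eta>] by (intro f_inv_into_f) (simp add: G D_def)
  define h where "h = (\<lambda>n u. order_stat_kernel n (k n) (G_m u))"
  have rank: "eventually (\<lambda>n. 1 \<le> k n \<and> k n \<le> n) sequentially"
    by (rule order_stat_rank_limit(1)[OF lim \<eta>])
  have h_meas [measurable]: "h n \<in> borel_measurable borel" for n
    unfolding h_def G by (rule borel_measurable_order_stat_kernel_cdf) (rule D.real_distribution_axioms)
  have h_nonneg: "0 \<le> h n u" for n u
    unfolding h_def G by (intro order_stat_kernel_nonneg D.cdf_nonneg D.cdf_bounded_prob)
  have h_bound: "h n u \<le> real n * real (n - 1 choose (k n - 1))" for n u
    unfolding h_def G by (intro order_stat_kernel_le D.cdf_nonneg D.cdf_bounded_prob)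
  have mass: "eventually (\<lambda>n. (\<integral>u. h n u * g_m u \<partial>lborel) = 1) sequentially"
    using rank
  proof eventually_elim
    case (elim n)
    then show ?case
      using integral_order_stat_kernel_cdf[OF m M X g_m copies, of n "k n"] by (simp add: h_def G D_def)
  qed
  \<comment> \<open>Distance from \<beta> in \<open>u\<close> becomes distance from \<eta> in
    \<open>G_m u\<close>, where the uniform decay of the kernel applies.\<close>
  have away: "uniform_limit {u. \<delta> \<le> \<bar>u - \<beta>\<bar>} h (\<lambda>_. 0) sequentially" if "0 < \<delta>" for \<delta>
  proof -
    obtain \<epsilon> where \<epsilon>: "0 < \<epsilon>" "\<And>u. \<delta> \<le> \<bar>u - \<beta>\<bar> \<Longrightarrow> \<epsilon> \<le> \<bar>cdf D u - cdf D \<beta>\<bar>"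
      using cdf_has_density_separated[OF M g_m assms(15,16) \<open>0 < \<delta>\<close>] unfolding D_def by blast
    have far: "G_m u \<in> {p. 0 \<le> p \<and> p \<le> 1 \<and> \<epsilon> \<le> \<bar>p - \<eta>\<bar>}" if "\<delta> \<le> \<bar>u - \<beta>\<bar>" for u
      using \<epsilon>(2)[OF that] D.cdf_nonneg D.cdf_bounded_prob by (simp add: G G_\<beta>[unfolded G])
    show ?thesis
    proof (rule uniform_limitI)
      fix e :: real assume "0 < e"
      from uniform_limitD[OF order_stat_kernel_uniform_limit[OF lim \<eta> \<epsilon>(1)] this]
      show "eventually (\<lambda>n. \<forall>u\<in>{u. \<delta> \<le> \<bar>u - \<beta>\<bar>}. dist (h n u) 0 < e) sequentially"
        unfolding h_def by (rule eventually_mono) (use far in blast)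
    qed
  qed
  \<comment> \<open>A countable union of null sets is null, so \<open>x\<close> can be fixed before
    \<open>n\<close> tends to infinity.\<close>
  have "AE x in lborel. \<forall>n. 1 \<le> k n \<and> k n \<le> n \<longrightarrow>
      f n (k n) x = fX 1 x * (\<integral>t. g_tail t * h n (x * t) \<partial>lborel)"
    unfolding AE_all_countable
  proof
    fix n
    show "AE x in lborel. 1 \<le> k n \<and> k n \<le> n \<longrightarrow>
        f n (k n) x = fX 1 x * (\<integral>t. g_tail t * h n (x * t) \<partial>lborel)"
    proof (cases "1 \<le> k n \<and> k n \<le> n")
      case True
      then have n: "1 \<le> n" and k: "1 \<le> k n" "k n \<le> n" by auto
      from first_factor_density_AE[OF m M X fX g_m g_tail copies[OF n] k f[OF k]] m
      show ?thesis
        by (auto simp: h_def G D_def)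
    qed auto
  qed
  then show ?thesis
    using assms(17) AE_lborel_singleton[of "0::real"]
  proof eventually_elim
    case (elim x)
    note formula = elim(1) and x = elim(3)
    \<comment> \<open>This is the density of \<open>x\<close> times the product of the remaining
      factors; \<open>x \<noteq> 0\<close> is needed for the scaling.\<close>
    define q where "q = (\<lambda>u. g_tail (u / x) / \<bar>x\<bar>)"
    have "integrable lborel (\<lambda>u. g_tail (0 + (1 / x) * u))"
      using elim(3) by (intro lborel_integrable_real_affine has_density_integrable[OF M g_tail]) auto
    then have q_int: "integrable lborel q"
      unfolding q_def by simp
    have "isCont (\<lambda>u. u / x) \<beta>"
      using x by (intro continuous_intros)
    then have "isCont (\<lambda>u. g_tail (u / x)) \<beta>"
      using elim(2) by (rule isCont_o2)
    then have q_cont: "isCont q \<beta>"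
      unfolding q_def using x by (intro isCont_divide continuous_const) auto
    have "(\<lambda>n. \<integral>u. h n u * q u \<partial>lborel) \<longlonglongrightarrow> q \<beta> / g_m \<beta>"
      using g_m by (intro concentrating_kernel_limit[OF h_meas h_nonneg h_bound has_density_integrable[OF M g_m]
            _ assms(15,16) q_int q_cont mass away]) (auto simp: has_density_def)
    then have "(\<lambda>n. fX 1 x * (\<integral>u. h n u * q u \<partial>lborel)) \<longlonglongrightarrow> fX 1 x * (q \<beta> / g_m \<beta>)"
      by (intro tendsto_intros)
    moreover have "eventually (\<lambda>n. fX 1 x * (\<integral>u. h n u * q u \<partial>lborel) = f n (k n) x) sequentially"
      using rank
    proof eventually_elim
      case (elim n)
      \<comment> \<open>The substitution \<open>u = x * t\<close> has Jacobian
        \<open>\<bar>x\<bar>\<close>, which cancels the denominator of \<open>q\<close>.\<close>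
      have "(\<integral>u. h n u * q u \<partial>lborel) = \<bar>x\<bar> *\<^sub>R (\<integral>t. h n (0 + x * t) * q (0 + x * t) \<partial>lborel)"
        using x by (rule lborel_integral_real_affine)
      also have "\<dots> = (\<integral>t. g_tail t * h n (x * t) \<partial>lborel)"
        using x by (simp add: q_def mult.commute)
      finally show ?case
        using formula elim by simp
    qed
    ultimately have "(\<lambda>n. f n (k n) x) \<longlonglongrightarrow> fX 1 x * (q \<beta> / g_m \<beta>)"
      by (rule Lim_transform_eventually)
    then show ?case
      by (simp add: q_def mult.commute)
  qed
qed

end
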